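(* For $N\ge 1$ let $-1<\tau_1<\tau_2<\cdots<\tau_N<1$ be the zeros of the Legendre polynomial $P_N$, and set $\tau_0=-1$. Let $\Lambda_N$ be the Lebesgue constant of the point set $\{\tau_0,\tau_1,\dots,\tau_N\}$. Then $\Lambda_N = O(\sqrt{N})$; that is, there is a constant $C$ independent of $N$ such that $\Lambda_N \le C\sqrt{N}$ for all $N\ge 1$.
   Context: $P_N$ is the Legendre polynomial of degree $N$ (the Jacobi polynomial $P_N^{(0,0)}$, orthogonal on $[-1,1]$ with weight $1$). For a point set $\{\tau_0,\dots,\tau_N\}$ of distinct points in $[-1,1]$, the Lagrange polynomials are $L_i(\tau)=\prod_{j=0,\,j\ne i}^N \frac{\tau-\tau_j}{\tau_i-\tau_j}$ and the Lebesgue constant is $\Lambda_N=\max\{\sum_{j=0}^N |L_j(\tau)| : \tau\in[-1,1]\}$. *)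

theory Defs
  imports "HOL-Analysis.Analysis" "HOL-Computational_Algebra.Polynomial"
begin

text \<open>Legendre polynomials P_n (Jacobi P_n^(0,0)), normalised by P_n(1) = 1, via Bonnet's
  three-term recurrence (n+2) P_(n+2) = (2n+3) x P_(n+1) - (n+1) P_n.\<close>
fun legendre_poly :: "nat \<Rightarrow> real poly" where
  "legendre_poly 0 = 1"
| "legendre_poly (Suc 0) = [:0, 1:]"
| "legendre_poly (Suc (Suc n)) =
     smult (1 / real (n + 2))
       (smult (real (2 * n + 3)) ([:0, 1:] * legendre_poly (Suc n))
        - smult (real (n + 1)) (legendre_poly n))"

definition lagrange_basis :: "real set \<Rightarrow> real \<Rightarrow> real \<Rightarrow> real" where
  "lagrange_basis T ti x = (\<Prod>tj\<in>T - {ti}. (x - tj) / (ti - tj))"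

definition lebesgue_constant :: "real set \<Rightarrow> real" where
  "lebesgue_constant T = (SUP x\<in>{-1..1}. \<Sum>ti\<in>T. \<bar>lagrange_basis T ti x\<bar>)"

definition legendre_radau_nodes :: "nat \<Rightarrow> real set" where
  "legendre_radau_nodes N = insert (-1) {x. poly (legendre_poly N) x = 0}"

end

theory Submission
  imports Defs
begin

text \<open>
  With \<open>x = cos t\<close>, the function \<open>u t = sqrt (sin t) * P\<^sub>n (cos t)\<close> solves \<open>u'' + q u = 0\<close> where
  \<open>q t = (n + 1/2)\<^sup>2 + 1 / (4 sin\<^sup>2 t)\<close>. Sturm comparison puts exactly one zero of \<open>P\<^sub>n\<close> into each of
  \<open>n\<close> explicit intervals of length \<open>\<pi> / (n + 1/2)\<close>. Monotonicity of \<open>u'\<^sup>2 + q u\<^sup>2\<close> and of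
  \<open>u\<^sup>2 + u'\<^sup>2 / q\<close> on each half of the interval bounds \<open>|P\<^sub>n'|\<close> at the zeros from below and
  \<open>|P\<^sub>n|\<close> from above. A Lagrange polynomial \<open>L\<^sub>k\<close> of the point set differs from the Lagrange
  polynomial \<open>l\<^sub>k\<close> of the zeros alone by \<open>P\<^sub>n(x) / (P\<^sub>n'(\<tau>\<^sub>k) (1 + \<tau>\<^sub>k))\<close>, and these corrections sum to
  \<open>O(sqrt n)\<close>. The at most three \<open>l\<^sub>k\<close> with \<open>\<tau>\<^sub>k\<close> next to \<open>x\<close> are \<open>O(sqrt n)\<close> each; at index distance \<open>j\<close>
  from \<open>x\<close>, \<open>l\<^sub>k = O(1 / sqrt j)\<close>, which again sums to \<open>O(sqrt n)\<close>.
\<close>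

section \<open>Legendre polynomials\<close>

lemma legendre_bonnet:
  "smult (real (n + 2)) (legendre_poly (Suc (Suc n)))
    = smult (real (2 * n + 3)) ([:0, 1:] * legendre_poly (Suc n))
      - smult (real (n + 1)) (legendre_poly n)"
  by (simp only: legendre_poly.simps smult_smult) simp

text \<open>Differentiating Bonnet's recurrence leaves the term \<open>D0\<close>, which the second
  identity at index \<open>n\<close> removes; the second identity at the next index then uses both.
  Hence one joint induction.\<close>

lemma legendre_derivative_recurrences:
  fixes n :: nat and x :: real
  shows "poly (pderiv (legendre_poly (Suc n))) x
           = x * poly (pderiv (legendre_poly n)) x + real (n + 1) * poly (legendre_poly n) x
       \<and> x * poly (pderiv (legendre_poly (Suc n))) x
           = poly (pderiv (legendre_poly n)) x + real (n + 1) * poly (legendre_poly (Suc n)) x"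
proof (induction n)
  case 0
  then show ?case by (simp add: pderiv_pCons)
next
  case (Suc n)
  define P0 P1 P2 where "P0 = poly (legendre_poly n) x" and "P1 = poly (legendre_poly (Suc n)) x"
    and "P2 = poly (legendre_poly (Suc (Suc n))) x"
  define D0 D1 D2 where "D0 = poly (pderiv (legendre_poly n)) x"
    and "D1 = poly (pderiv (legendre_poly (Suc n))) x"
    and "D2 = poly (pderiv (legendre_poly (Suc (Suc n)))) x"
  have P2: "real (n + 2) * P2 = real (2 * n + 3) * x * P1 - real (n + 1) * P0"
    unfolding P0_def P1_def P2_def by simp
  have "real (n + 2) * D2 = real (2 * n + 3) * (P1 + x * D1) - real (n + 1) * D0"
    using arg_cong[OF legendre_bonnet[of n], of "\<lambda>p. poly (pderiv p) x"]
    unfolding P1_def D0_def D1_def D2_def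
    by (simp add: pderiv_smult pderiv_diff pderiv_mult pderiv_pCons algebra_simps
        del: legendre_poly.simps)
  moreover have IH: "D1 = x * D0 + real (n + 1) * P0" "x * D1 = D0 + real (n + 1) * P1"
    using Suc unfolding P0_def P1_def D0_def D1_def by auto
  ultimately have "real (n + 2) * D2
      = real (2 * n + 3) * (P1 + x * D1) - real (n + 1) * (x * D1 - real (n + 1) * P1)"
    by simp
  also have "\<dots> = real (n + 2) * (x * D1 + real (n + 2) * P1)"
    by (simp add: algebra_simps)
  finally have "real (n + 2) * D2 = real (n + 2) * (x * D1 + real (n + 2) * P1)" .
  then have D2: "D2 = x * D1 + real (n + 2) * P1"
    by simp
  have "x * D2 = x * (x * D1) + real (n + 2) * x * P1"
    using D2 by (simp add: algebra_simps)
  also have "x * (x * D1) = D1 - real (n + 1) * P0 + real (n + 1) * x * P1"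
    using IH by (simp add: algebra_simps)
  finally have "x * D2 = D1 + real (n + 2) * P2"
    using P2 by (simp add: algebra_simps)
  with D2 show ?case
    unfolding P1_def P2_def D1_def D2_def by (simp del: legendre_poly.simps)
qed

text \<open>Eliminates the derivative of \<open>legendre_poly n\<close> between the two recurrences.
  It yields the differential equation and the derivative at 0.\<close>

lemma legendre_deriv_via_previous:
  fixes x :: real
  shows "(x\<^sup>2 - 1) * poly (pderiv (legendre_poly (Suc n))) x
    = real (n + 1) * (x * poly (legendre_poly (Suc n)) x - poly (legendre_poly n) x)"
proof -
  let ?P = "poly (legendre_poly n) x" and ?P' = "poly (legendre_poly (Suc n)) x"
    and ?D = "poly (pderiv (legendre_poly n)) x" and ?D' = "poly (pderiv (legendre_poly (Suc n))) x"
  have "(x\<^sup>2 - 1) * ?D' = x * (x * ?D') - ?D'"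
    by (simp add: algebra_simps power2_eq_square del: legendre_poly.simps)
  also have "\<dots> = x * (?D + real (n + 1) * ?P') - (x * ?D + real (n + 1) * ?P)"
    using legendre_derivative_recurrences[of n x]
    by (intro arg_cong2[of _ _ _ _ "\<lambda>u v. x * u - v"]) auto
  also have "\<dots> = real (n + 1) * (x * ?P' - ?P)"
    by (simp add: algebra_simps del: legendre_poly.simps)
  finally show ?thesis .
qed

text \<open>Differentiate the preceding identity, read as one between polynomials, and remove the
  derivative of the polynomial of index \<open>n - 1\<close> by the second recurrence.\<close>

lemma legendre_ode:
  fixes x :: real
  assumes "n \<ge> 1"
  shows "(1 - x\<^sup>2) * poly (pderiv (pderiv (legendre_poly n))) x
    = 2 * x * poly (pderiv (legendre_poly n)) x - real n * real (n + 1) * poly (legendre_poly n) x"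
proof -
  obtain m where n: "n = Suc m" using assms by (cases n) auto
  let ?P = "legendre_poly n" and ?Q = "legendre_poly m"
  have "[:-1, 0, 1:] * pderiv ?P = smult (real (m + 1)) ([:0, 1:] * ?P - ?Q)"
    by (intro poly_ext) (use legendre_deriv_via_previous[of _ m] n in
      \<open>simp add: algebra_simps power2_eq_square del: legendre_poly.simps\<close>)
  then have "poly (pderiv ([:-1, 0, 1:] * pderiv ?P)) x
      = poly (pderiv (smult (real (m + 1)) ([:0, 1:] * ?P - ?Q))) x"
    by simp
  then have "(x\<^sup>2 - 1) * poly (pderiv (pderiv ?P)) x + 2 * x * poly (pderiv ?P) x
      = real (m + 1) * (poly ?P x + (x * poly (pderiv ?P) x - poly (pderiv ?Q) x))"
    by (simp add: pderiv_smult pderiv_diff pderiv_mult pderiv_pCons algebra_simps power2_eq_square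
        del: legendre_poly.simps)
  also have "x * poly (pderiv ?P) x - poly (pderiv ?Q) x = real (m + 1) * poly ?P x"
    using legendre_derivative_recurrences[of m x] unfolding n by linarith
  finally show ?thesis
    using n by (simp add: algebra_simps del: legendre_poly.simps)
qed

lemma legendre_at_1 [simp]: "poly (legendre_poly n) 1 = 1"
  by (induction n rule: legendre_poly.induct) (auto simp: field_simps)

lemma legendre_at_minus_1 [simp]: "poly (legendre_poly n) (-1) = (-1) ^ n"
  by (induction n rule: legendre_poly.induct) (auto simp: field_simps)

lemma degree_legendre_le: "degree (legendre_poly n) \<le> n"
proof (induction n rule: legendre_poly.induct)
  case (3 n)
  have "degree ([:0, 1:] * legendre_poly (Suc n)) \<le> Suc (Suc n)"
    using degree_mult_le[of "[:0, 1:]" "legendre_poly (Suc n)"] 3 by simp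
  with 3 show ?case
    by (auto intro!: degree_diff_le degree_smult_le[THEN order_trans] simp del: mult_pCons_left)
qed auto

section \<open>Uniform bounds on \<open>[-1, 1]\<close>\<close>

lemma real_deriv_nonneg_imp_le:
  fixes f :: "real \<Rightarrow> real"
  assumes "a \<le> b"
    and "\<And>x. a \<le> x \<Longrightarrow> x \<le> b \<Longrightarrow> (f has_real_derivative f' x) (at x)"
    and "\<And>x. a \<le> x \<Longrightarrow> x \<le> b \<Longrightarrow> 0 \<le> f' x"
  shows "f a \<le> f b"
  by (rule DERIV_nonneg_imp_nondecreasing) (use assms in \<open>auto intro!: exI[of _ "f' _"]\<close>)

lemma real_deriv_nonpos_imp_ge:
  fixes f :: "real \<Rightarrow> real"
  assumes "a \<le> b"
    and "\<And>x. a \<le> x \<Longrightarrow> x \<le> b \<Longrightarrow> (f has_real_derivative f' x) (at x)"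
    and "\<And>x. a \<le> x \<Longrightarrow> x \<le> b \<Longrightarrow> f' x \<le> 0"
  shows "f b \<le> f a"
  by (rule DERIV_nonpos_imp_nonincreasing) (use assms in \<open>auto intro!: exI[of _ "f' _"]\<close>)

text \<open>Sonin's energy, monotone on each half of the interval.\<close>
lemma sonin_energy_le:
  fixes p :: "real poly" and K x :: real
  assumes ode: "\<And>x. (1 - x\<^sup>2) * poly (pderiv (pderiv p)) x = 2 * x * poly (pderiv p) x - K * poly p x"
    and K: "K > 0" and ends: "\<bar>poly p 1\<bar> = 1" "\<bar>poly p (-1)\<bar> = 1" and x: "\<bar>x\<bar> \<le> 1"
  shows "(poly p x)\<^sup>2 + (1 - x\<^sup>2) * (poly (pderiv p) x)\<^sup>2 / K \<le> 1"
proof -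
  let ?D = "poly (pderiv p)" and ?E = "poly (pderiv (pderiv p))"
  define f where "f x = (poly p x)\<^sup>2 + (1 - x\<^sup>2) * (?D x)\<^sup>2 / K" for x
  \<comment> \<open>The differential equation cancels the mixed term \<open>2 * p * p'\<close>, so
    the derivative has the sign of \<open>x\<close>. Thus \<open>f\<close> is largest at the ends,
    where the weight \<open>1 - x^2\<close> vanishes.\<close>
  have der: "(f has_real_derivative 2 * x * (?D x)\<^sup>2 / K) (at x)" for x
  proof -
    have "(f has_real_derivative
        2 * poly p x * ?D x + (- 2 * x * (?D x)\<^sup>2 + 2 * ?D x * ((1 - x\<^sup>2) * ?E x)) / K) (at x)"
      unfolding f_def using K by (auto intro!: derivative_eq_intros poly_DERIV)
    then show ?thesis
      unfolding ode using K by (simp add: field_simps power2_eq_square)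
  qed
  have ends': "f 1 = 1" "f (-1) = 1"
    using ends by (simp_all add: f_def abs_square_eq_1)
  have "f x \<le> 1"
  proof (cases "x \<ge> 0")
    case True
    then have "f x \<le> f 1"
      using x K by (intro real_deriv_nonneg_imp_le[OF _ der]) auto
    then show ?thesis by (simp add: ends')
  next
    case False
    then have "f x \<le> f (-1)"
      using x K by (intro real_deriv_nonpos_imp_ge[OF _ der])
        (simp_all add: divide_nonpos_pos mult_nonpos_nonneg)
    then show ?thesis by (simp add: ends')
  qed
  then show ?thesis by (simp add: f_def)
qed

lemma legendre_energy_le_1:
  fixes x :: real
  assumes "n \<ge> 1" "\<bar>x\<bar> \<le> 1"
  shows "(poly (legendre_poly n) x)\<^sup>2
    + (1 - x\<^sup>2) * (poly (pderiv (legendre_poly n)) x)\<^sup>2 / (real n * real (n + 1)) \<le> 1"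
  using assms by (intro sonin_energy_le legendre_ode) (auto simp: power_abs)

lemma abs_legendre_le_1:
  assumes "\<bar>x\<bar> \<le> 1"
  shows "\<bar>poly (legendre_poly n) x\<bar> \<le> 1"
proof (cases "n = 0")
  case False
  have "x\<^sup>2 \<le> 1" using assms by (simp add: abs_square_le_1)
  then have "0 \<le> (1 - x\<^sup>2) * (poly (pderiv (legendre_poly n)) x)\<^sup>2 / (real n * real (n + 1))"
    by simp
  with legendre_energy_le_1[of n x] False assms
  have "(poly (legendre_poly n) x)\<^sup>2 \<le> 1" by linarith
  then show ?thesis by (simp add: abs_square_le_1)
qed auto

lemma abs_sin_legendre_deriv_le:
  assumes "n \<ge> 1"
  shows "\<bar>sin t * poly (pderiv (legendre_poly n)) (cos t)\<bar> \<le> real n + 1"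
proof -
  have K: "real n * real (n + 1) > 0" using assms by simp
  have "(1 - (cos t)\<^sup>2) * (poly (pderiv (legendre_poly n)) (cos t))\<^sup>2 / (real n * real (n + 1)) \<le> 1"
    using legendre_energy_le_1[OF assms abs_cos_le_one, of t]
      zero_le_power2[of "poly (legendre_poly n) (cos t)"] by linarith
  then have "(sin t)\<^sup>2 * (poly (pderiv (legendre_poly n)) (cos t))\<^sup>2 \<le> real n * real (n + 1)"
    using K by (simp add: sin_squared_eq field_simps)
  also have "\<dots> \<le> (real n + 1)\<^sup>2" by (simp add: power2_eq_square algebra_simps)
  finally have "(sin t * poly (pderiv (legendre_poly n)) (cos t))\<^sup>2 \<le> (real n + 1)\<^sup>2"
    by (simp add: power_mult_distrib)
  then show ?thesis
    by (subst (asm) power2_le_iff_abs_le) auto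
qed

text \<open>Mean value theorem with the preceding bound. It keeps the numerator of a Lagrange
  polynomial small when its node is close to the argument.\<close>

lemma legendre_cos_lipschitz:
  assumes "n \<ge> 1"
  shows "\<bar>poly (legendre_poly n) (cos s) - poly (legendre_poly n) (cos t)\<bar>
    \<le> (real n + 1) * \<bar>s - t\<bar>"
proof -
  have *: "\<bar>poly (legendre_poly n) (cos b) - poly (legendre_poly n) (cos a)\<bar> \<le> (real n + 1) * (b - a)"
    if "a < b" for a b :: real
  proof -
    have "\<exists>z. a < z \<and> z < b \<and> poly (legendre_poly n) (cos b) - poly (legendre_poly n) (cos a)
        = (b - a) * (- (sin z * poly (pderiv (legendre_poly n)) (cos z)))"
      using that by (intro MVT2)
        (auto intro!: derivative_eq_intros poly_DERIV[THEN DERIV_chain2])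
    then obtain z where z: "poly (legendre_poly n) (cos b) - poly (legendre_poly n) (cos a)
        = (b - a) * (- (sin z * poly (pderiv (legendre_poly n)) (cos z)))" by blast
    show ?thesis
      using mult_left_mono[OF abs_sin_legendre_deriv_le[OF assms, of z], of "b - a"] that
      unfolding z abs_mult[of "b - a"] abs_minus_cancel by (simp add: mult.commute)
  qed
  consider "s < t" | "s = t" | "t < s" by linarith
  then show ?thesis
    using *[of s t] *[of t s] by cases (auto simp: abs_minus_commute)
qed

text \<open>One of the two values vanishes by parity and the other has square of order
  \<open>1 / n\<close>; the sum of both squares hides the parity. Along steps of two,
  \<open>n + 2\<close> times the sum never increases and \<open>n\<close> times the sum never
  decreases.\<close>

lemma legendre_squares_at_0:
  "real (n + 2) * ((poly (legendre_poly n) 0)\<^sup>2 + (poly (legendre_poly (Suc n)) 0)\<^sup>2) \<le> 2"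
  "n \<ge> 1 \<Longrightarrow> 1 / 4 \<le> real n * ((poly (legendre_poly n) 0)\<^sup>2 + (poly (legendre_poly (Suc n)) 0)\<^sup>2)"
proof -
  define a where "a k = (poly (legendre_poly k) 0)\<^sup>2" for k
  have rec: "a (Suc (Suc k)) = (real (k + 1))\<^sup>2 / (real (k + 2))\<^sup>2 * a k" for k
    by (simp add: a_def power2_eq_square)
  have rec': "a (Suc (Suc (Suc k))) = (real (k + 2))\<^sup>2 / (real (k + 3))\<^sup>2 * a (Suc k)" for k
    using rec[of "Suc k"] by (simp add: algebra_simps)
  have a0: "a k \<ge> 0" for k by (simp add: a_def)
  have up: "real (k + 4) * a (Suc (Suc k)) \<le> real (k + 2) * a k"
    "real (k + 4) * a (Suc (Suc (Suc k))) \<le> real (k + 2) * a (Suc k)" for k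
  proof -
    have *: "real (k + 4) * ((real (k + 1))\<^sup>2 / (real (k + 2))\<^sup>2) \<le> real (k + 2)"
      "real (k + 4) * ((real (k + 2))\<^sup>2 / (real (k + 3))\<^sup>2) \<le> real (k + 2)"
      unfolding times_divide_eq_right
      by (rule mult_imp_div_pos_le, simp, simp add: algebra_simps power2_eq_square)+
    from *[THEN mult_right_mono, OF a0]
    show "real (k + 4) * a (Suc (Suc k)) \<le> real (k + 2) * a k"
      by (simp_all only: rec mult.assoc)
    from *[THEN mult_right_mono, OF a0]
    show "real (k + 4) * a (Suc (Suc (Suc k))) \<le> real (k + 2) * a (Suc k)"
      by (simp_all only: rec' mult.assoc)
  qed
  have lo: "real k * a k \<le> real (k + 2) * a (Suc (Suc k))"
    "real k * a (Suc k) \<le> real (k + 2) * a (Suc (Suc (Suc k)))" for k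
  proof -
    have *: "real k \<le> real (k + 2) * ((real (k + 1))\<^sup>2 / (real (k + 2))\<^sup>2)"
      "real k \<le> real (k + 2) * ((real (k + 2))\<^sup>2 / (real (k + 3))\<^sup>2)"
      unfolding times_divide_eq_right
      by (rule mult_imp_le_div_pos, simp, simp add: algebra_simps power2_eq_square)+
    from *[THEN mult_right_mono, OF a0]
    show "real k * a k \<le> real (k + 2) * a (Suc (Suc k))"
      by (simp_all only: rec mult.assoc)
    from *[THEN mult_right_mono, OF a0]
    show "real k * a (Suc k) \<le> real (k + 2) * a (Suc (Suc (Suc k)))"
      by (simp_all only: rec' mult.assoc)
  qed
  have init: "a 0 = 1" "a 1 = 0" "a 2 = 1 / 4" "a 3 = 0"
    by (simp_all add: a_def numeral_2_eq_2 numeral_3_eq_3 power2_eq_square)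
  have "real (n + 2) * (a n + a (Suc n)) \<le> 2"
  proof (induction n rule: nat_induct2)
    case 0 then show ?case using init by simp
  next
    case 1 then show ?case using init by (simp add: numeral_2_eq_2)
  next
    case (step k)
    with up[of k] show ?case by (simp add: algebra_simps)
  qed
  then show "real (n + 2) * ((poly (legendre_poly n) 0)\<^sup>2 + (poly (legendre_poly (Suc n)) 0)\<^sup>2) \<le> 2"
    by (simp only: a_def)
  have "n \<ge> 1 \<longrightarrow> 1 / 4 \<le> real n * (a n + a (Suc n))"
  proof (induction n rule: nat_induct2)
    case 1 then show ?case using init by (simp add: numeral_2_eq_2)
  next
    case (step k)
    show ?case
    \<comment> \<open>At \<open>k = 0\<close> the induction hypothesis is void, so index 2 is
      checked directly.\<close>
    proof (cases "k = 0")
      case True then show ?thesis using init by (simp add: numeral_2_eq_2 numeral_3_eq_3)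
    next
      case False
      with step lo[of k] show ?thesis by (simp add: algebra_simps)
    qed
  qed auto
  then show "n \<ge> 1 \<Longrightarrow> 1 / 4 \<le> real n * ((poly (legendre_poly n) 0)\<^sup>2 + (poly (legendre_poly (Suc n)) 0)\<^sup>2)"
    by (simp only: a_def)
qed

section \<open>Liouville's substitution\<close>

definition liouville :: "real poly \<Rightarrow> real \<Rightarrow> real" where
  "liouville p t = sqrt (sin t) * poly p (cos t)"

definition liouville_deriv :: "real poly \<Rightarrow> real \<Rightarrow> real" where
  "liouville_deriv p t = cos t / (2 * sqrt (sin t)) * poly p (cos t)
    - sin t * sqrt (sin t) * poly (pderiv p) (cos t)"

text \<open>For \<open>K = n * (n + 1)\<close> the constant part \<open>K + 1 / 4\<close> is
  \<open>(n + 1 / 2)^2\<close>, the squared frequency used in the Sturm comparison.\<close>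

definition liouville_potential :: "real \<Rightarrow> real \<Rightarrow> real" where
  "liouville_potential K t = K + 1 / 4 + 1 / (4 * (sin t)\<^sup>2)"

lemma DERIV_liouville:
  assumes "sin t > 0"
  shows "(liouville p has_real_derivative liouville_deriv p t) (at t)"
proof -
  have "((\<lambda>t. poly p (cos t)) has_real_derivative poly (pderiv p) (cos t) * (- sin t)) (at t)"
    by (rule DERIV_chain2[OF poly_DERIV DERIV_cos])
  then show ?thesis
    unfolding liouville_def[abs_def] liouville_deriv_def
    using assms by (auto intro!: derivative_eq_intros simp: field_simps)
qed

text \<open>The factor \<open>sqrt (sin t)\<close> is chosen so that the first-order terms cancel.
  In \<open>r = sqrt (sin t)\<close> and \<open>c = cos t\<close> all coefficients are rational, and
  since \<open>1 - c^2 = r^4\<close> the equation for \<open>p\<close> replaces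
  \<open>r^4 * E\<close>, which removes \<open>D\<close>.\<close>

lemma DERIV_liouville_deriv:
  fixes p :: "real poly"
  assumes ode: "\<And>x. (1 - x\<^sup>2) * poly (pderiv (pderiv p)) x = 2 * x * poly (pderiv p) x - K * poly p x"
    and "sin t > 0"
  shows "(liouville_deriv p has_real_derivative - liouville_potential K t * liouville p t) (at t)"
proof -
  define r c where "r = sqrt (sin t)" and "c = cos t"
  define P D E where "P = poly p c" and "D = poly (pderiv p) c" and "E = poly (pderiv (pderiv p)) c"
  have r: "r > 0" "sin t = r\<^sup>2" using assms by (simp_all add: r_def)
  have c2: "c\<^sup>2 = 1 - r ^ 4"
    using r unfolding c_def by (simp add: cos_squared_eq flip: power_mult)
  have ode': "r ^ 4 * E = 2 * c * D - K * P"
    using ode[of c] unfolding c2 P_def D_def E_def by simp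
  have R: "sin t = r\<^sup>2" "cos t = c" "sqrt (r\<^sup>2) = r"
    using r by (simp_all add: c_def)
  have dP: "((\<lambda>t. poly p (cos t)) has_real_derivative D * (- r\<^sup>2)) (at t)"
    by (rule DERIV_cong[OF DERIV_chain2[OF poly_DERIV DERIV_cos]]) (simp add: R D_def)
  have dD: "((\<lambda>t. poly (pderiv p) (cos t)) has_real_derivative E * (- r\<^sup>2)) (at t)"
    by (rule DERIV_cong[OF DERIV_chain2[OF poly_DERIV DERIV_cos]]) (simp add: R E_def)
  have dr: "((\<lambda>t. sqrt (sin t)) has_real_derivative c / (2 * r)) (at t)"
    by (rule DERIV_cong[OF DERIV_chain2[OF DERIV_real_sqrt DERIV_sin]])
       (use r in \<open>simp_all add: R field_simps\<close>)
  have d1: "((\<lambda>t. cos t / (2 * sqrt (sin t))) has_real_derivative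
      (- r\<^sup>2 * (2 * r) - c * (2 * (c / (2 * r)))) / (2 * r * (2 * r))) (at t)"
    by (rule DERIV_cong[OF DERIV_divide[OF DERIV_cos DERIV_cmult[OF dr]]])
       (use r(1) in \<open>simp_all add: R\<close>)
  have d2: "((\<lambda>t. sin t * sqrt (sin t)) has_real_derivative c * r + c / (2 * r) * r\<^sup>2) (at t)"
    by (rule DERIV_cong[OF DERIV_mult[OF DERIV_sin dr]]) (use r(1) in \<open>simp add: R\<close>)
  have "(liouville_deriv p has_real_derivative
      ((- r\<^sup>2 * (2 * r) - c * (2 * (c / (2 * r)))) / (2 * r * (2 * r)) * P + D * (- r\<^sup>2) * (c / (2 * r)))
      - ((c * r + c / (2 * r) * r\<^sup>2) * D + E * (- r\<^sup>2) * (r\<^sup>2 * r))) (at t)"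
    unfolding liouville_deriv_def[abs_def]
    by (rule DERIV_cong[OF DERIV_diff[OF DERIV_mult[OF d1 dP] DERIV_mult[OF d2 dD]]])
       (use r(1) in \<open>simp add: R P_def D_def\<close>)
  also have "(- r\<^sup>2 * (2 * r) - c * (2 * (c / (2 * r)))) / (2 * r * (2 * r))
      = - (r / 2) - c\<^sup>2 / (4 * r ^ 3)"
    using r(1) by (simp add: field_simps power2_eq_square power3_eq_cube)
  also have "D * (- r\<^sup>2) * (c / (2 * r)) = - (r * c / 2) * D"
    using r(1) by (simp add: power2_eq_square)
  also have "c * r + c / (2 * r) * r\<^sup>2 = 3 / 2 * (c * r)"
    using r(1) by (simp add: power2_eq_square)
  also have "(- (r / 2) - c\<^sup>2 / (4 * r ^ 3)) * P + - (r * c / 2) * D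
      - (3 / 2 * (c * r) * D + E * (- r\<^sup>2) * (r\<^sup>2 * r))
      = (- (r / 2) - c\<^sup>2 / (4 * r ^ 3)) * P - 2 * (c * r * D) + r * (r ^ 4 * E)"
    by (simp add: algebra_simps power2_eq_square power4_eq_xxxx)
  also have "\<dots> = (- (r / 2) - c\<^sup>2 / (4 * r ^ 3) - r * K) * P"
    unfolding ode' by (simp add: algebra_simps)
  also have "- (r / 2) - c\<^sup>2 / (4 * r ^ 3) - r * K = - (K + 1 / 4 + 1 / (4 * (r\<^sup>2)\<^sup>2)) * r"
  proof -
    have "c\<^sup>2 / (4 * r ^ 3) = 1 / (4 * r ^ 3) - r / 4"
      unfolding c2 using r(1)
      by (simp add: diff_divide_distrib power3_eq_cube power4_eq_xxxx)
    moreover have "1 / (4 * (r\<^sup>2)\<^sup>2) * r = 1 / (4 * r ^ 3)"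
      using r(1) by (simp add: power2_eq_square power3_eq_cube)
    ultimately show ?thesis by (simp add: algebra_simps)
  qed
  finally show ?thesis
    by (simp only: liouville_potential_def liouville_def R P_def mult.assoc)
qed

lemma DERIV_liouville_potential:
  assumes "sin t > 0"
  shows "(liouville_potential K has_real_derivative - cos t / (2 * sin t ^ 3)) (at t)"
proof -
  have "((\<lambda>t. 1 / (4 * (sin t)\<^sup>2)) has_real_derivative
      (0 * (4 * (sin t)\<^sup>2) - 1 * (4 * (2 * sin t * cos t))) / (4 * (sin t)\<^sup>2 * (4 * (sin t)\<^sup>2))) (at t)"
    using assms by (intro DERIV_divide DERIV_cmult derivative_eq_intros) auto
  also have "(0 * (4 * (sin t)\<^sup>2) - 1 * (4 * (2 * sin t * cos t))) / (4 * (sin t)\<^sup>2 * (4 * (sin t)\<^sup>2))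
      = - cos t / (2 * sin t ^ 3)"
    using assms by (simp add: power2_eq_square power3_eq_cube)
  finally show ?thesis
    unfolding liouville_potential_def[abs_def]
    by (intro DERIV_cong[OF DERIV_add[OF DERIV_const]]) auto
qed

text \<open>A common criterion for both energies: \<open>cos\<close> passes from plus to minus at
  \<open>pi / 2\<close>, so with \<open>g\<close> nonpositive \<open>f\<close> falls before the
  middle and rises after it.\<close>

lemma monotone_away_from_middle:
  fixes f :: "real \<Rightarrow> real"
  assumes der: "\<And>t. 0 < t \<Longrightarrow> t < pi \<Longrightarrow> (f has_real_derivative cos t * g t) (at t)"
    and g: "\<And>t. 0 < t \<Longrightarrow> t < pi \<Longrightarrow> g t \<le> 0" and t: "0 < t" "t < pi"
  shows "f (pi / 2) \<le> f t"
proof (cases "t \<le> pi / 2")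
  case True
  have "cos s * g s \<le> 0" if "t \<le> s" "s \<le> pi / 2" for s
    by (rule mult_nonneg_nonpos) (use that t in \<open>auto intro!: cos_ge_zero g\<close>)
  with True t show ?thesis
    by (intro real_deriv_nonpos_imp_ge[where f = f and f' = "\<lambda>t. cos t * g t", OF _ der]) auto
next
  case False
  have "0 \<le> cos s * g s" if "pi / 2 \<le> s" "s \<le> t" for s
  proof (rule mult_nonpos_nonpos)
    show "cos s \<le> 0" using cos_ge_zero[of "pi - s"] that t by simp
    show "g s \<le> 0" using that t pi_half_gt_zero by (intro g) linarith+
  qed
  moreover have "0 < s" if "pi / 2 \<le> s" for s :: real
    using that pi_half_gt_zero by linarith
  ultimately show ?thesis
    using False t
    by (intro real_deriv_nonneg_imp_le[where f = f and f' = "\<lambda>t. cos t * g t", OF _ der]) auto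
qed

section \<open>Energies and zeros of polynomial solutions\<close>

locale legendre_equation =
  fixes p :: "real poly" and K :: real
  assumes ode: "\<And>x. (1 - x\<^sup>2) * poly (pderiv (pderiv p)) x = 2 * x * poly (pderiv p) x - K * poly p x"
    and K_pos: "K > 0"
begin

lemma potential_pos: "liouville_potential K t > 0"
  using K_pos unfolding liouville_potential_def by (simp add: add_pos_nonneg)

text \<open>The derivative of \<open>u'^2 + q * u^2\<close> is \<open>q' * u^2\<close>, because
  \<open>u'' = - q * u\<close>. At \<open>pi / 2\<close> one has \<open>u = p(0)\<close>,
  \<open>u' = - p'(0)\<close> and \<open>q = K + 1 / 2\<close>. At a zero of \<open>u\<close> this
  bounds \<open>u'\<close> from below.\<close>

lemma energy_ge_middle:
  assumes t: "0 < t" "t < pi"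
  shows "(poly (pderiv p) 0)\<^sup>2 + (K + 1 / 2) * (poly p 0)\<^sup>2
    \<le> (liouville_deriv p t)\<^sup>2 + liouville_potential K t * (liouville p t)\<^sup>2"
proof -
  define h where "h t = (liouville_deriv p t)\<^sup>2 + liouville_potential K t * (liouville p t)\<^sup>2" for t
  have "(h has_real_derivative cos t * (- (liouville p t)\<^sup>2 / (2 * sin t ^ 3))) (at t)"
    if "0 < t" "t < pi" for t
  proof -
    have s: "sin t > 0" using that by (rule sin_gt_zero)
    have "((\<lambda>t. (liouville_deriv p t)\<^sup>2) has_real_derivative
        2 * liouville_deriv p t * (- liouville_potential K t * liouville p t)) (at t)"
      by (rule DERIV_cong[OF DERIV_power[OF DERIV_liouville_deriv[OF ode s]]]) simp
    moreover have "((\<lambda>t. (liouville p t)\<^sup>2) has_real_derivative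
        2 * liouville p t * liouville_deriv p t) (at t)"
      by (rule DERIV_cong[OF DERIV_power[OF DERIV_liouville[OF s]]]) simp
    ultimately have "(h has_real_derivative
        2 * liouville_deriv p t * (- liouville_potential K t * liouville p t)
        + (- cos t / (2 * sin t ^ 3) * (liouville p t)\<^sup>2
          + 2 * liouville p t * liouville_deriv p t * liouville_potential K t)) (at t)"
      unfolding h_def by (intro DERIV_add DERIV_mult DERIV_liouville_potential[OF s])
    then show ?thesis by (rule DERIV_cong) simp
  qed
  then have "h (pi / 2) \<le> h t"
    by (rule monotone_away_from_middle[where g = "\<lambda>t. - (liouville p t)\<^sup>2 / (2 * sin t ^ 3)"])
       (use t in \<open>auto intro!: divide_nonneg_nonneg mult_nonneg_nonneg sin_ge_zero\<close>)
  moreover have "h (pi / 2) = (poly (pderiv p) 0)\<^sup>2 + (K + 1 / 2) * (poly p 0)\<^sup>2"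
    by (simp add: h_def liouville_def liouville_deriv_def liouville_potential_def)
  ultimately show ?thesis by (simp add: h_def)
qed

lemma amplitude_le_middle:
  assumes t: "0 < t" "t < pi"
  shows "(liouville p t)\<^sup>2 \<le> (poly p 0)\<^sup>2 + (poly (pderiv p) 0)\<^sup>2 / (K + 1 / 2)"
proof -
  \<comment> \<open>The sign is reversed so that the criterion for a minimum at the middle yields a
    maximum of \<open>u^2 + u'^2 / q\<close>, whose derivative is
    \<open>- q' * u'^2 / q^2\<close>.\<close>
  define g where "g t = - ((liouville p t)\<^sup>2 + (liouville_deriv p t)\<^sup>2 / liouville_potential K t)" for t
  have "(g has_real_derivative
      cos t * (- (liouville_deriv p t)\<^sup>2 / (2 * sin t ^ 3 * (liouville_potential K t)\<^sup>2))) (at t)"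
    if "0 < t" "t < pi" for t
  proof -
    let ?q = "liouville_potential K t"
    have s: "sin t > 0" using that by (rule sin_gt_zero)
    have q: "?q \<noteq> 0" using potential_pos[of t] by simp
    have "(g has_real_derivative - (2 * liouville p t * liouville_deriv p t
        + (2 * liouville_deriv p t * (- ?q * liouville p t) * ?q
          - (liouville_deriv p t)\<^sup>2 * (- cos t / (2 * sin t ^ 3))) / (?q * ?q))) (at t)"
      unfolding g_def using q
      by (auto intro!: derivative_eq_intros DERIV_liouville[OF s] DERIV_liouville_deriv[OF ode s]
          DERIV_liouville_potential[OF s])
    then show ?thesis
      by (rule DERIV_cong) (use q s in \<open>simp add: field_simps power2_eq_square\<close>)
  qed
  then have "g (pi / 2) \<le> g t"
    by (rule monotone_away_from_middle[where g = "\<lambda>t. - (liouville_deriv p t)\<^sup>2 / (2 * sin t ^ 3 * (liouville_potential K t)\<^sup>2)"])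
       (use t in \<open>auto intro!: divide_nonneg_nonneg mult_nonneg_nonneg sin_ge_zero\<close>)
  moreover have "g (pi / 2) = - ((poly p 0)\<^sup>2 + (poly (pderiv p) 0)\<^sup>2 / (K + 1 / 2))"
    by (simp add: g_def liouville_def liouville_deriv_def liouville_potential_def)
  moreover have "- g t \<ge> (liouville p t)\<^sup>2"
    using potential_pos[of t] by (simp add: g_def)
  ultimately show ?thesis by linarith
qed

text \<open>Sturm comparison with \<open>v'' + L\<^sup>2 v = 0\<close>, through the Wronskian.\<close>
lemma exists_zero_in_interval:
  assumes L: "L > 0" "L\<^sup>2 \<le> K + 1 / 4" and ab: "0 < a" "a + pi / L < pi"
  shows "\<exists>t. a < t \<and> t < a + pi / L \<and> poly p (cos t) = 0"
proof (rule ccontr)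
  assume no: "\<not> ?thesis"
  define b where "b = a + pi / L"
  have ab': "a < b" "b < pi" using L ab by (simp_all add: b_def)
  have nz: "liouville p t \<noteq> 0" if "a < t" "t < b" for t
  proof -
    have "sin t > 0" using that ab ab' by (intro sin_gt_zero) auto
    then show ?thesis using no that by (auto simp: liouville_def b_def)
  qed
  have cont: "continuous_on {a..b} (liouville p)"
  proof (intro continuous_at_imp_continuous_on ballI)
    fix t assume "t \<in> {a..b}"
    then have "sin t > 0" using ab ab' by (intro sin_gt_zero) auto
    then show "isCont (liouville p) t" by (rule DERIV_isCont[OF DERIV_liouville])
  qed
  \<comment> \<open>Without zeros inside, the intermediate value theorem forbids a change of sign.
    The point \<open>s\<close> may be an endpoint, where \<open>u\<close> may vanish, hence the weak
    inequality.\<close>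
  have same_sign: "liouville p s * liouville p t \<ge> 0" if st: "s \<in> {a..b}" "a < t" "t < b" for s t
  proof (rule ccontr)
    define f where "f x = liouville p t * liouville p x" for x
    assume "\<not> ?thesis"
    then have f: "f s < 0" "f t > 0"
      using nz[OF st(2,3)] by (auto simp: f_def mult.commute not_le zero_less_mult_iff)
    have f_cont: "continuous_on {a..b} f"
      unfolding f_def by (intro continuous_intros cont)
    have "\<exists>x. a < x \<and> x < b \<and> f x = 0"
    proof (cases "s < t")
      case True
      then obtain x where "s \<le> x" "x \<le> t" "f x = 0"
        using IVT'[of f s 0 t] f st continuous_on_subset[OF f_cont, of "{s..t}"] by auto
      with f st show ?thesis by (intro exI[of _ x]) (cases "x = s"; auto)
    next
      case False
      then obtain x where "t \<le> x" "x \<le> s" "f x = 0"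
        using IVT2'[of f s 0 t] f st continuous_on_subset[OF f_cont, of "{t..s}"] by auto
      with f st show ?thesis by (intro exI[of _ x]) (cases "x = s"; auto)
    qed
    then show False using nz nz[OF st(2,3)] by (auto simp: f_def)
  qed
  define m where "m = (a + b) / 2"
  have m: "a < m" "m < b" using ab' by (auto simp: m_def)
  \<comment> \<open>Multiplying by the value at the midpoint makes \<open>u\<close> positive inside
    and spares a case distinction on its sign.\<close>
  define e where "e = liouville p m"
  have e: "e * liouville p t > 0" if "a < t" "t < b" for t
    using same_sign[of t m] nz[OF that] nz[OF m] that m
    by (auto simp: e_def mult.commute less_le)
  have e_end: "e * liouville p a \<ge> 0" "e * liouville p b \<ge> 0"
    using same_sign[of a m] same_sign[of b m] m by (auto simp: e_def mult.commute)
  \<comment> \<open>The Wronskian of \<open>e * u\<close> with \<open>v = sin (L * (t - a))\<close>,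
    which vanishes at \<open>a\<close> and \<open>b\<close> and is positive between. It decreases
    strictly, yet \<open>v' = L\<close> at \<open>a\<close> and \<open>v' = - L\<close> at
    \<open>b\<close> give \<open>W a \<le> 0 \<le> W b\<close>.\<close>
  define W where "W t = e * (liouville_deriv p t * sin (L * (t - a)) - liouville p t * (L * cos (L * (t - a))))" for t
  have derW: "(W has_real_derivative (L\<^sup>2 - liouville_potential K t) * (e * liouville p t) * sin (L * (t - a))) (at t)"
    if "a \<le> t" "t \<le> b" for t
  proof -
    have s: "sin t > 0" using that ab ab' by (intro sin_gt_zero) auto
    have "(W has_real_derivative
      e * ((- liouville_potential K t * liouville p t) * sin (L * (t - a))
          + liouville_deriv p t * (L * cos (L * (t - a)))
        - (liouville_deriv p t * (L * cos (L * (t - a)))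
          + liouville p t * (L * (- sin (L * (t - a)) * L))))) (at t)"
      unfolding W_def
      by (auto intro!: derivative_eq_intros DERIV_liouville[OF s] DERIV_liouville_deriv[OF ode s])
    then show ?thesis
      by (rule DERIV_cong) (simp add: algebra_simps power2_eq_square)
  qed
  have "W b < W a"
  proof (rule DERIV_neg_imp_decreasing_open[OF ab'(1)])
    fix t assume t: "a < t" "t < b"
    have "L * (t - a) < L * (pi / L)"
      using t L by (intro mult_strict_left_mono) (auto simp: b_def)
    then have "sin (L * (t - a)) > 0"
      using L t by (intro sin_gt_zero) auto
    \<comment> \<open>The term \<open>1 / (4 * (sin t)^2)\<close> makes this strict even when
      \<open>L^2 = K + 1 / 4\<close>, the case used for Legendre polynomials.\<close>
    moreover have "L\<^sup>2 - liouville_potential K t < 0"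
    proof -
      have "sin t > 0" using t ab ab' by (intro sin_gt_zero) auto
      then have "0 < 1 / (4 * (sin t)\<^sup>2)" by simp
      then show ?thesis using L unfolding liouville_potential_def by linarith
    qed
    ultimately have "(L\<^sup>2 - liouville_potential K t) * (e * liouville p t) * sin (L * (t - a)) < 0"
      using e[OF t] by (intro mult_neg_pos)
    with derW[of t] t show "\<exists>y. (W has_real_derivative y) (at t) \<and> y < 0"
      by (intro exI[of _ "(L\<^sup>2 - liouville_potential K t) * (e * liouville p t) * sin (L * (t - a))"]) auto
  next
    show "continuous_on {a..b} W"
      using derW by (intro continuous_at_imp_continuous_on ballI) (auto intro: DERIV_isCont)
  qed
  moreover have "W a = - L * (e * liouville p a)" "W b = L * (e * liouville p b)"
    using L by (simp_all add: W_def b_def)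
  ultimately show False
    using mult_nonneg_nonneg[OF less_imp_le[OF L(1)] e_end(1)]
      mult_nonneg_nonneg[OF less_imp_le[OF L(1)] e_end(2)] by linarith
qed

end

section \<open>Size and zeros of Legendre polynomials\<close>

lemma legendre_equation_legendre_poly:
  "n \<ge> 1 \<Longrightarrow> legendre_equation (legendre_poly n) (real n * real (n + 1))"
  by unfold_locales (simp_all add: legendre_ode)

lemma legendre_deriv_at_0:
  "poly (pderiv (legendre_poly (Suc n))) 0 = real (n + 1) * poly (legendre_poly n) 0"
  using legendre_deriv_via_previous[of 0 n] by (simp del: legendre_poly.simps)

text \<open>A form of Bernstein's inequality. The left side is \<open>u^2\<close>, bounded by its
  amplitude at the middle; as \<open>P_n'(0) = n * P_(n-1)(0)\<close> and
  \<open>n^2 \<le> K\<close>, that amplitude is at most the sum of two consecutive squares at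
  0.\<close>

lemma legendre_bernstein:
  assumes "n \<ge> 1" and t: "0 \<le> t" "t \<le> pi"
  shows "sin t * (poly (legendre_poly n) (cos t))\<^sup>2 \<le> 2 / real n"
proof (cases "t = 0 \<or> t = pi")
  case False
  with t have t': "0 < t" "t < pi" by auto
  obtain m where n: "n = Suc m" using assms by (cases n) auto
  define a b where "a = (poly (legendre_poly m) 0)\<^sup>2" and "b = (poly (legendre_poly n) 0)\<^sup>2"
  define K where "K = real n * real (n + 1)"
  have K: "K > 0" "(real n)\<^sup>2 \<le> K" using assms(1) by (simp_all add: K_def power2_eq_square)
  have s: "sin t > 0" using t' by (rule sin_gt_zero)
  have "sin t * (poly (legendre_poly n) (cos t))\<^sup>2 = (liouville (legendre_poly n) t)\<^sup>2"
    using s by (simp add: liouville_def power_mult_distrib)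
  also have "\<dots> \<le> b + (real n)\<^sup>2 * a / (K + 1 / 2)"
    using legendre_equation.amplitude_le_middle[OF legendre_equation_legendre_poly[OF assms(1)] t']
    unfolding b_def a_def K_def n legendre_deriv_at_0 by (simp only: power_mult_distrib Suc_eq_plus1)
  also have "(real n)\<^sup>2 * a / (K + 1 / 2) \<le> a"
  proof -
    have a0: "a \<ge> 0" by (simp add: a_def)
    have "(real n)\<^sup>2 * a \<le> a * (K + 1 / 2)"
      using mult_right_mono[OF K(2) a0] a0 by (simp add: algebra_simps)
    then show ?thesis using K(1) by (simp add: pos_divide_le_eq)
  qed
  also have "b + a \<le> 2 / real n"
  proof -
    have "real (m + 2) * (a + b) \<le> 2"
      using legendre_squares_at_0(1)[of m] unfolding a_def b_def n .
    moreover have "real n * (a + b) \<le> real (m + 2) * (a + b)"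
      by (intro mult_right_mono) (simp_all add: n a_def b_def)
    ultimately show ?thesis
      using assms(1) by (simp add: le_divide_eq algebra_simps)
  qed
  finally show ?thesis by simp
qed auto

text \<open>At a zero \<open>u\<close> vanishes and \<open>u'\<close> is, up to sign, the right-hand
  side, so the energy is its square. The energy at the middle is at least
  \<open>n / 4\<close>.\<close>

lemma legendre_deriv_at_zero_ge:
  assumes n1: "n \<ge> 1" and t: "0 < t" "t < pi" and z: "poly (legendre_poly n) (cos t) = 0"
  shows "sqrt (real n) / 2 \<le> sin t * sqrt (sin t) * \<bar>poly (pderiv (legendre_poly n)) (cos t)\<bar>"
proof -
  obtain m where n: "n = Suc m" using assms by (cases n) auto
  define a b where "a = (poly (legendre_poly m) 0)\<^sup>2" and "b = (poly (legendre_poly n) 0)\<^sup>2"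
  define K where "K = real n * real (n + 1)"
  have s: "sin t > 0" using t by (rule sin_gt_zero)
  have "1 / 4 \<le> real n * (a + b)"
  proof (cases "m = 0")
    case True
    then show ?thesis by (simp add: n a_def b_def)
  next
    case False
    then have "1 / 4 \<le> real m * (a + b)"
      using legendre_squares_at_0(2)[of m] unfolding a_def b_def n by linarith
    also have "\<dots> \<le> real n * (a + b)"
      by (intro mult_right_mono) (simp_all add: n a_def b_def)
    finally show ?thesis .
  qed
  from mult_left_mono[OF this, of "real n"]
  have "real n / 4 \<le> (real n)\<^sup>2 * a + (real n)\<^sup>2 * b"
    by (simp add: power2_eq_square algebra_simps)
  also have "(real n)\<^sup>2 * b \<le> (K + 1 / 2) * b"
    by (intro mult_right_mono) (simp_all add: K_def b_def power2_eq_square algebra_simps)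
  also have "(real n)\<^sup>2 * a + (K + 1 / 2) * b
      \<le> (liouville_deriv (legendre_poly n) t)\<^sup>2
        + liouville_potential K t * (liouville (legendre_poly n) t)\<^sup>2"
    using legendre_equation.energy_ge_middle[OF legendre_equation_legendre_poly[OF n1] t]
    unfolding b_def a_def K_def n legendre_deriv_at_0 by (simp only: power_mult_distrib Suc_eq_plus1)
  also have "\<dots> = (sin t * sqrt (sin t) * \<bar>poly (pderiv (legendre_poly n)) (cos t)\<bar>)\<^sup>2"
    using z by (simp add: liouville_def liouville_deriv_def power_mult_distrib)
  finally have "(sqrt (real n) / 2)\<^sup>2
      \<le> (sin t * sqrt (sin t) * \<bar>poly (pderiv (legendre_poly n)) (cos t)\<bar>)\<^sup>2"
    by (simp add: power_divide)
  then show ?thesis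
    by (rule power2_le_imp_le) (use s in simp)
qed

text \<open>The intervals have length \<open>pi / L\<close> with \<open>L = n + 1 / 2\<close>, so
  Sturm comparison applies with \<open>L^2 = n * (n + 1) + 1 / 4\<close>. They abut and stay
  \<open>pi / (4 * L)\<close> away from 0 and \<open>pi\<close>; each midpoint
  \<open>(k - 1 / 4) * pi / L\<close> is the classical asymptotic position of the zero. The angles
  increase with \<open>k\<close>, so the zeros are numbered from the right.\<close>

lemma legendre_zeros:
  assumes n1: "n \<ge> 1"
  obtains \<theta> :: "nat \<Rightarrow> real" where
    "\<And>k. k \<in> {1..n} \<Longrightarrow> (real k - 3 / 4) * pi / (real n + 1 / 2) < \<theta> k"
    "\<And>k. k \<in> {1..n} \<Longrightarrow> \<theta> k < (real k + 1 / 4) * pi / (real n + 1 / 2)"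
    "inj_on (\<lambda>k. cos (\<theta> k)) {1..n}"
    "{x. poly (legendre_poly n) x = 0} = (\<lambda>k. cos (\<theta> k)) ` {1..n}"
proof -
  interpret legendre_equation "legendre_poly n" "real n * real (n + 1)"
    by (rule legendre_equation_legendre_poly[OF n1])
  define L where "L = real n + 1 / 2"
  have L: "L > 0" "L\<^sup>2 \<le> real n * real (n + 1) + 1 / 4"
    by (simp_all add: L_def power2_eq_square algebra_simps)
  have "\<exists>t. (real k - 3 / 4) * pi / L < t \<and> t < (real k + 1 / 4) * pi / L
      \<and> poly (legendre_poly n) (cos t) = 0" if "k \<in> {1..n}" for k
  proof -
    have eq: "(real k - 3 / 4) * pi / L + pi / L = (real k + 1 / 4) * pi / L"
      unfolding add_divide_distrib[symmetric] by (rule arg_cong) (simp add: algebra_simps)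
    have "(real k + 1 / 4) * pi / L < pi"
      using that L(1) by (simp add: divide_less_eq L_def)
    moreover have "0 < (real k - 3 / 4) * pi / L"
      using that L(1) by simp
    ultimately show ?thesis
      using exists_zero_in_interval[OF L, of "(real k - 3 / 4) * pi / L"] unfolding eq by blast
  qed
  then have "\<forall>k\<in>{1..n}. \<exists>t. (real k - 3 / 4) * pi / L < t \<and> t < (real k + 1 / 4) * pi / L
      \<and> poly (legendre_poly n) (cos t) = 0" by blast
  from bchoice[OF this] obtain \<theta> where \<theta>: "\<And>k. k \<in> {1..n} \<Longrightarrow> (real k - 3 / 4) * pi / L < \<theta> k
      \<and> \<theta> k < (real k + 1 / 4) * pi / L \<and> poly (legendre_poly n) (cos (\<theta> k)) = 0"
    by blast
  have in_pi: "0 < \<theta> k \<and> \<theta> k < pi" if "k \<in> {1..n}" for k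
  proof -
    have "(real k + 1 / 4) * pi / L < pi"
      using that L(1) by (simp add: divide_less_eq L_def)
    moreover have "0 < (real k - 3 / 4) * pi / L"
      using that L(1) by simp
    ultimately show ?thesis using \<theta>[OF that] by linarith
  qed
  have "strict_mono_on {1..n} \<theta>"
  proof (rule strict_mono_onI)
    fix j k assume jk: "j \<in> {1..n}" "k \<in> {1..n}" "j < k"
    then have "(real j + 1 / 4) * pi / L \<le> (real k - 3 / 4) * pi / L"
      using L(1) by (intro divide_right_mono mult_right_mono) auto
    then show "\<theta> j < \<theta> k" using \<theta>[OF jk(1)] \<theta>[OF jk(2)] by linarith
  qed
  then have "inj_on \<theta> {1..n}" by (rule strict_mono_on_imp_inj_on)
  then have inj: "inj_on (\<lambda>k. cos (\<theta> k)) {1..n}"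
    using in_pi by (intro comp_inj_on[of \<theta> _ cos, unfolded comp_def])
      (auto intro!: inj_onI cos_inj_pi intro: less_imp_le)
  have nz: "legendre_poly n \<noteq> 0"
    using legendre_at_1[of n] by (auto simp del: legendre_at_1)
  have "(\<lambda>k. cos (\<theta> k)) ` {1..n} = {x. poly (legendre_poly n) x = 0}"
  \<comment> \<open>There are \<open>n\<close> distinct zeros and the degree is at most
    \<open>n\<close>, so no others exist.\<close>
  proof (rule card_seteq)
    show "finite {x. poly (legendre_poly n) x = 0}" using nz by (rule poly_roots_finite)
    show "(\<lambda>k. cos (\<theta> k)) ` {1..n} \<subseteq> {x. poly (legendre_poly n) x = 0}" using \<theta> by auto
    show "card {x. poly (legendre_poly n) x = 0} \<le> card ((\<lambda>k. cos (\<theta> k)) ` {1..n})"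
      unfolding card_image[OF inj] using card_poly_roots_bound[OF nz] degree_legendre_le[of n] by simp
  qed
  with inj \<theta> show ?thesis by (intro that[of \<theta>]) (auto simp: L_def)
qed

section \<open>Lagrange products in terms of a polynomial with the given zeros\<close>

lemma poly_eq_prod_roots:
  fixes p :: "real poly"
  assumes fin: "finite Z" and Z: "\<And>x. poly p x = 0 \<longleftrightarrow> x \<in> Z" and deg: "degree p \<le> card Z"
  obtains c where "c \<noteq> 0" "p = smult c (\<Prod>s\<in>Z. [:- s, 1:])"
proof -
  \<comment> \<open>The extra point \<open>y\<close> fixes the constant: \<open>p\<close> and the
    scaled product then agree on \<open>insert y Z\<close>, which has more points than either
    degree.\<close>
  obtain y where y: "y \<notin> Z" using ex_new_if_finite[OF infinite_UNIV_char_0 fin] by blast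
  let ?R = "\<Prod>s\<in>Z. [:- s, 1:]"
  define c where "c = poly p y / poly ?R y"
  have R: "poly ?R y \<noteq> 0" using fin y by (auto simp: poly_prod)
  have c: "c \<noteq> 0" using R y Z by (simp add: c_def)
  have "degree ?R \<le> card Z"
    using degree_prod_sum_le[OF fin, of "\<lambda>s. [:- s, 1:]"] by simp
  then have deg_R: "degree (smult c ?R) \<le> card Z"
    using degree_smult_le[of c ?R] by linarith
  have "p = smult c ?R"
  proof (rule poly_eqI_degree[of "insert y Z"])
    fix x assume "x \<in> insert y Z"
    then show "poly p x = poly (smult c ?R) x"
    proof
      assume "x = y"
      then show ?thesis using R by (simp add: c_def)
    next
      assume x: "x \<in> Z"
      then have "poly ?R x = 0" using fin by (auto simp: poly_prod prod_zero_iff)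
      moreover have "poly p x = 0" using x Z by blast
      ultimately show ?thesis by simp
    qed
  qed (use deg deg_R fin y in \<open>simp_all del: degree_smult_eq\<close>)
  with c show ?thesis by (rule that)
qed

text \<open>The classical \<open>p(x) / ((x - t) * p'(t))\<close>, multiplied out so that
  \<open>x = t\<close> is covered as well.\<close>

lemma lagrange_prod_at_root:
  fixes p :: "real poly"
  assumes fin: "finite Z" and Z: "\<And>x. poly p x = 0 \<longleftrightarrow> x \<in> Z" and deg: "degree p \<le> card Z"
    and t: "t \<in> Z"
  shows "(\<Prod>s\<in>Z - {t}. (x - s) / (t - s)) * (x - t) * poly (pderiv p) t = poly p x"
proof -
  obtain c where c: "p = smult c (\<Prod>s\<in>Z. [:- s, 1:])"
    using poly_eq_prod_roots[OF assms(1-3)] .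
  define q where "q = (\<Prod>s\<in>Z - {t}. [:- s, 1:])"
  have p: "p = smult c ([:- t, 1:] * q)"
    unfolding c q_def using fin t by (subst prod.remove) auto
  have "poly (pderiv p) t = c * poly q t"
    unfolding p by (simp add: pderiv_smult pderiv_mult pderiv_pCons del: mult_pCons_left)
  moreover have "poly p x = c * ((x - t) * poly q x)"
    unfolding p by (simp del: mult_pCons_left)
  moreover have "poly q t \<noteq> 0" using fin by (auto simp: q_def poly_prod)
  moreover have "(\<Prod>s\<in>Z - {t}. (x - s) / (t - s)) = poly q x / poly q t"
    by (simp add: q_def poly_prod prod_dividef)
  ultimately show ?thesis by simp
qed

lemma lagrange_prod_off_roots:
  fixes p :: "real poly"
  assumes fin: "finite Z" and Z: "\<And>x. poly p x = 0 \<longleftrightarrow> x \<in> Z" and deg: "degree p \<le> card Z"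
    and y: "y \<notin> Z"
  shows "(\<Prod>s\<in>Z. (x - s) / (y - s)) = poly p x / poly p y"
proof -
  obtain c where c: "c \<noteq> 0" "p = smult c (\<Prod>s\<in>Z. [:- s, 1:])"
    using poly_eq_prod_roots[OF assms(1-3)] .
  show ?thesis unfolding c(2) using c(1) by (simp add: poly_prod prod_dividef)
qed

section \<open>Elementary estimates\<close>

lemma jordan_sin_ge:
  fixes x :: real
  assumes "0 \<le> x" "x \<le> pi / 2"
  shows "2 * x / pi \<le> sin x"
proof -
  have "concave_on {0..pi / 2} sin"
    by (rule f''_le0_imp_concave[where f' = cos and f'' = "\<lambda>x. - sin x"])
       (auto intro!: derivative_eq_intros sin_ge_zero)
  moreover define u where "u = 2 * x / pi"
  moreover have "0 \<le> u" "u \<le> 1" using assms by (simp_all add: u_def divide_le_eq)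
  ultimately have "(1 - u) * sin 0 + u * sin (pi / 2) \<le> sin ((1 - u) *\<^sub>R 0 + u *\<^sub>R (pi / 2))"
    using pi_half_ge_zero by (intro concave_onD) auto
  then show ?thesis by (simp add: u_def)
qed

text \<open>Turns distance of angles into distance of nodes. In
  \<open>cos a - cos b = 2 * sin ((a + b) / 2) * sin ((b - a) / 2)\<close> the first factor, with
  its 2, is at least \<open>sin b\<close>, by the formula for \<open>sin a + sin b\<close>; the
  second is bounded by Jordan's inequality.\<close>

lemma abs_cos_diff_ge:
  fixes a b :: real
  assumes "a \<in> {0..pi}" "b \<in> {0..pi}"
  shows "sin b * \<bar>a - b\<bar> / pi \<le> \<bar>cos a - cos b\<bar>"
proof -
  have "sin b \<le> sin a + sin b" using assms by (simp add: sin_ge_zero)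
  also have "\<dots> = 2 * sin ((a + b) / 2) * cos ((a - b) / 2)" by (rule sin_plus_sin)
  also have "\<dots> \<le> 2 * sin ((a + b) / 2) * 1"
    using assms by (intro mult_left_mono) (auto intro!: mult_nonneg_nonneg sin_ge_zero)
  finally have 1: "sin b \<le> 2 * sin ((a + b) / 2)" by simp
  have "\<bar>sin ((b - a) / 2)\<bar> = sin (\<bar>a - b\<bar> / 2)"
  proof (cases "a \<le> b")
    case True
    then have "0 \<le> sin ((b - a) / 2)" using assms by (intro sin_ge_zero) auto
    then show ?thesis using True by simp
  next
    case False
    then have "sin ((b - a) / 2) = - sin ((a - b) / 2)"
      using sin_minus[of "(a - b) / 2"] by (simp add: minus_divide_left)
    then show ?thesis using False assms by (auto intro!: abs_of_nonneg sin_ge_zero)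
  qed
  then have 2: "\<bar>a - b\<bar> / pi \<le> \<bar>sin ((b - a) / 2)\<bar>"
    using jordan_sin_ge[of "\<bar>a - b\<bar> / 2"] assms by (auto simp: abs_le_iff)
  have "sin b * (\<bar>a - b\<bar> / pi) \<le> 2 * sin ((a + b) / 2) * \<bar>sin ((b - a) / 2)\<bar>"
    using assms by (intro mult_mono 1 2) (auto intro!: mult_nonneg_nonneg sin_ge_zero)
  also have "\<dots> = \<bar>cos a - cos b\<bar>"
    unfolding cos_diff_cos abs_mult
    using assms sin_ge_zero[of "(a + b) / 2"] by auto
  finally show ?thesis by simp
qed

lemma sin_le_sin_plus_abs_diff:
  fixes a b :: real
  shows "sin b \<le> sin a + \<bar>a - b\<bar>"
proof -
  have "sin b - sin a = 2 * sin ((b - a) / 2) * cos ((b + a) / 2)"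
    by (rule sin_diff_sin)
  also have "\<dots> \<le> \<bar>2 * sin ((b - a) / 2)\<bar> * \<bar>cos ((b + a) / 2)\<bar>"
    unfolding abs_mult[symmetric] by (rule abs_ge_self)
  also have "\<dots> \<le> \<bar>2 * sin ((b - a) / 2)\<bar> * 1"
    by (intro mult_left_mono) auto
  also have "\<dots> \<le> \<bar>a - b\<bar>"
    using abs_sin_x_le_abs_x[of "(b - a) / 2"] by (simp add: abs_mult abs_minus_commute)
  finally show ?thesis by simp
qed

section \<open>Sums of inverse square roots\<close>

lemma sum_inverse_sqrt_le: "(\<Sum>k = 1..n. 1 / sqrt (real k)) \<le> 2 * sqrt (real n)"
proof (induction n)
  case (Suc n)
  \<comment> \<open>Each summand is at most twice a difference of consecutive square roots, so the
    sum telescopes.\<close>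
  have "1 \<le> 2 * sqrt (real (Suc n)) * (sqrt (real (Suc n)) - sqrt (real n))"
  proof -
    define x y where "x = sqrt (real (Suc n))" and "y = sqrt (real n)"
    have "x * x = y * y + 1" by (simp add: x_def y_def)
    moreover have "2 * (x * y) \<le> x * x + y * y"
      using sum_squares_bound[of x y] by (simp add: power2_eq_square mult.assoc)
    ultimately show ?thesis
      unfolding x_def[symmetric] y_def[symmetric] by (simp add: algebra_simps)
  qed
  then have "1 / sqrt (real (Suc n)) \<le> 2 * (sqrt (real (Suc n)) - sqrt (real n))"
    by (subst pos_divide_le_eq) (simp_all only: mult_ac, simp_all)
  with Suc show ?case by simp
qed simp

lemma sum_inverse_sqrt_reindex_le:
  assumes "finite A" "inj_on h A" "h ` A \<subseteq> {1..n}"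
  shows "(\<Sum>k\<in>A. 1 / sqrt (real (h k))) \<le> 2 * sqrt (real n)"
proof -
  have "(\<Sum>k\<in>A. 1 / sqrt (real (h k))) = (\<Sum>j\<in>h ` A. 1 / sqrt (real j))"
    using assms(2) by (simp add: sum.reindex)
  also have "\<dots> \<le> (\<Sum>j = 1..n. 1 / sqrt (real j))"
    using assms(3) by (intro sum_mono2) auto
  finally show ?thesis using sum_inverse_sqrt_le[of n] by linarith
qed

lemma sum_inverse_sqrt_dist_le:
  assumes "m \<le> n + 1"
  shows "(\<Sum>k = 1..n. 1 / sqrt \<bar>real k - real m\<bar>) \<le> 4 * sqrt (real n)"
proof -
  have "(\<Sum>k = 1..n. 1 / sqrt \<bar>real k - real m\<bar>)
      = (\<Sum>k\<in>{k\<in>{1..n}. k < m}. 1 / sqrt \<bar>real k - real m\<bar>)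
        + (\<Sum>k\<in>{k\<in>{1..n}. \<not> k < m}. 1 / sqrt \<bar>real k - real m\<bar>)"
    by (subst sum.union_disjoint[symmetric]) (auto intro!: sum.cong)
  also have "(\<Sum>k\<in>{k\<in>{1..n}. k < m}. 1 / sqrt \<bar>real k - real m\<bar>)
      = (\<Sum>k\<in>{k\<in>{1..n}. k < m}. 1 / sqrt (real (m - k)))"
    by (intro sum.cong) (auto simp: of_nat_diff)
  also have "\<dots> \<le> 2 * sqrt (real n)"
    using assms by (intro sum_inverse_sqrt_reindex_le) (auto intro!: inj_onI)
  \<comment> \<open>The term \<open>k = m\<close> is \<open>1 / sqrt 0\<close>, which is 0 by
    convention, and drops out.\<close>
  also have "(\<Sum>k\<in>{k\<in>{1..n}. \<not> k < m}. 1 / sqrt \<bar>real k - real m\<bar>)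
      = (\<Sum>k\<in>{k\<in>{1..n}. m < k}. 1 / sqrt (real (k - m)))"
    by (rule sum.mono_neutral_cong_right) (auto simp: of_nat_diff)
  also have "\<dots> \<le> 2 * sqrt (real n)"
    using assms by (intro sum_inverse_sqrt_reindex_le) (auto intro!: inj_onI)
  finally show ?thesis by simp
qed

section \<open>The Lebesgue constant\<close>

text \<open>The hypothesis on \<open>l\<close> is the product form of a Lagrange polynomial at the
  zeros. The factor \<open>\<bar>t - s\<bar>\<close> from the Lipschitz bound of the numerator
  cancels against the one from the cosine difference. At \<open>t = s\<close> the product form reads
  \<open>0 = 0\<close>, so \<open>l = 1\<close> is required separately.\<close>

lemma node_factor_near:
  assumes n: "n \<ge> 1" and t: "t \<in> {0..pi}" and s: "0 < s" "s < pi"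
    and root: "poly (legendre_poly n) (cos s) = 0"
    and l: "l * (cos t - cos s) * poly (pderiv (legendre_poly n)) (cos s) = poly (legendre_poly n) (cos t)"
    and l1: "t = s \<Longrightarrow> l = 1"
  shows "\<bar>l\<bar> \<le> 16 * sqrt (real n)"
proof (cases "t = s")
  case True
  moreover have "1 \<le> sqrt (real n)" using n by simp
  ultimately have "1 \<le> 16 * sqrt (real n)" by linarith
  then show ?thesis using l1 True by simp
next
  case False
  define D where "D = \<bar>poly (pderiv (legendre_poly n)) (cos s)\<bar>"
  define d where "d = \<bar>t - s\<bar>"
  have d: "d > 0" using False by (simp add: d_def)
  have sin: "0 < sin s" using s by (rule sin_gt_zero)
  have "\<bar>l\<bar> * (sin s * d / pi) * D \<le> \<bar>l\<bar> * \<bar>cos t - cos s\<bar> * D"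
    using abs_cos_diff_ge[of t s] t s unfolding d_def D_def
    by (intro mult_right_mono mult_left_mono) auto
  also have "\<dots> = \<bar>poly (legendre_poly n) (cos t)\<bar>"
    unfolding l[symmetric] D_def by (simp add: abs_mult)
  also have "\<dots> \<le> (real n + 1) * d"
    using legendre_cos_lipschitz[OF n, of t s] root by (simp add: d_def)
  finally have "(\<bar>l\<bar> * (sin s * D)) * d \<le> ((real n + 1) * pi) * d"
    by (simp add: field_simps)
  then have 1: "\<bar>l\<bar> * (sin s * D) \<le> (real n + 1) * pi" using d by simp
  have "sqrt (real n) / 2 \<le> sin s * sqrt (sin s) * D"
    unfolding D_def by (rule legendre_deriv_at_zero_ge[OF n s root])
  also have "\<dots> \<le> sin s * 1 * D"
    using sin by (intro mult_right_mono mult_left_mono) (auto simp: D_def)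
  finally have "\<bar>l\<bar> * (sqrt (real n) / 2) \<le> \<bar>l\<bar> * (sin s * D)"
    by (intro mult_left_mono) auto
  also note 1
  also have "(real n + 1) * pi \<le> (2 * real n) * 4"
    using n pi_less_4 by (intro mult_mono) auto
  also have "\<dots> = (16 * sqrt (real n)) * (sqrt (real n) / 2)" by simp
  finally show ?thesis
    by (rule mult_right_le_imp_le) (use n in simp)
qed

text \<open>Here Bernstein's inequality bounds the numerator instead, so the distance
  \<open>d\<close> stays in the denominator and \<open>\<bar>l\<bar>\<close> is of order
  \<open>1 / sqrt (n * d)\<close>.\<close>

lemma node_factor_far:
  assumes n: "n \<ge> 1" and t: "t \<in> {0..pi}" and s: "0 < s" "s < pi"
    and root: "poly (legendre_poly n) (cos s) = 0"
    and l: "l * (cos t - cos s) * poly (pderiv (legendre_poly n)) (cos s) = poly (legendre_poly n) (cos t)"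
    and j: "1 \<le> j" "j / real n \<le> \<bar>t - s\<bar>"
  shows "\<bar>l\<bar> \<le> 20 / sqrt j"
proof -
  define D where "D = \<bar>poly (pderiv (legendre_poly n)) (cos s)\<bar>"
  define d where "d = \<bar>t - s\<bar>"
  define P where "P = \<bar>poly (legendre_poly n) (cos t)\<bar>"
  have n0: "real n > 0" using n by simp
  have d: "d > 0" "j \<le> d * real n" using j n0 by (auto simp: d_def divide_le_eq intro: less_le_trans[rotated])
  have sin: "0 < sin s" using s by (rule sin_gt_zero)
  have P: "0 \<le> P" "P \<le> 1" by (simp_all add: P_def abs_legendre_le_1)
  have sP: "sqrt (sin t) * P \<le> sqrt (2 / real n)"
  proof -
    have "sin t * P\<^sup>2 \<le> 2 / real n"
      using legendre_bernstein[OF n, of t] t by (simp add: P_def)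
    then have "sqrt (sin t * P\<^sup>2) \<le> sqrt (2 / real n)" by (rule real_sqrt_le_mono)
    then show ?thesis using P by (simp add: real_sqrt_mult)
  qed
  \<comment> \<open>Moves the weight from the node to the argument, where Bernstein's inequality
    holds, at the price of \<open>sqrt d\<close>.\<close>
  have root_sin: "sqrt (sin s) \<le> sqrt (sin t) + sqrt d"
  proof -
    have "sqrt (sin s) \<le> sqrt (sin t + d)"
      using sin_le_sin_plus_abs_diff[of s t] by (simp add: d_def)
    also have "\<dots> \<le> sqrt (sin t) + sqrt d"
      using t d by (intro sqrt_add_le_add_sqrt) (auto intro: sin_ge_zero)
    finally show ?thesis .
  qed
  have "\<bar>l\<bar> * (sin s * d / pi) * D \<le> \<bar>l\<bar> * \<bar>cos t - cos s\<bar> * D"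
    using abs_cos_diff_ge[of t s] t s unfolding d_def D_def
    by (intro mult_right_mono mult_left_mono) auto
  also have "\<dots> = P"
    unfolding P_def l[symmetric] D_def by (simp add: abs_mult)
  finally have 1: "\<bar>l\<bar> * (sin s * D * d) \<le> pi * P"
    by (simp add: field_simps)
  have "\<bar>l\<bar> * (sqrt (real n) / 2 * d) \<le> \<bar>l\<bar> * (sin s * sqrt (sin s) * D * d)"
    unfolding D_def using d by (intro mult_left_mono mult_right_mono legendre_deriv_at_zero_ge[OF n s root]) auto
  also have "\<dots> = sqrt (sin s) * (\<bar>l\<bar> * (sin s * D * d))" by (simp add: mult_ac)
  also have "\<dots> \<le> (sqrt (sin t) + sqrt d) * (pi * P)"
    using sin d t by (intro mult_mono root_sin 1) (auto simp: D_def sin_ge_zero)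
  also have "\<dots> = pi * (sqrt (sin t) * P + sqrt d * P)" by (simp add: algebra_simps)
  also have "\<dots> \<le> 4 * (sqrt (2 / real n) + sqrt d * 1)"
    using pi_less_4 sP P d t by (intro mult_mono add_mono mult_left_mono) (auto simp: sin_ge_zero)
  \<comment> \<open>Since \<open>1 / n \<le> d\<close>, both summands are of order
    \<open>sqrt d\<close>; together they give \<open>4 * (3 / 2 + 1) = 10\<close>.\<close>
  also have "sqrt (2 / real n) \<le> 3 / 2 * sqrt d"
  proof -
    have "1 \<le> d * real n" using d(2) j(1) by linarith
    then have "2 / real n \<le> 9 / 4 * d" using n0 by (simp add: divide_le_eq)
    then have "sqrt (2 / real n) \<le> sqrt (9 / 4 * d)" by (rule real_sqrt_le_mono)
    also have "\<dots> = 3 / 2 * sqrt d"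
      by (simp add: real_sqrt_mult real_sqrt_divide)
    finally show ?thesis .
  qed
  finally have "\<bar>l\<bar> * (sqrt (real n) / 2 * d) \<le> 10 * sqrt d" by simp
  moreover have "(\<bar>l\<bar> * (sqrt (real n) * sqrt d)) * sqrt d = 2 * (\<bar>l\<bar> * (sqrt (real n) / 2 * d))"
    using d(1) by (simp add: mult.assoc)
  ultimately have "(\<bar>l\<bar> * (sqrt (real n) * sqrt d)) * sqrt d \<le> 20 * sqrt d"
    by linarith
  then have "\<bar>l\<bar> * (sqrt (real n) * sqrt d) \<le> 20" using d(1) by simp
  moreover have "\<bar>l\<bar> * sqrt j \<le> \<bar>l\<bar> * (sqrt (real n) * sqrt d)"
    using d(2) by (intro mult_left_mono) (auto simp: mult.commute simp flip: real_sqrt_mult)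
  ultimately show ?thesis using j(1) by (subst pos_le_divide_eq) auto
qed

text \<open>Bounds the correction caused by the node -1. As \<open>1 + cos s\<close> is at least
  \<open>(sin s)^2 / 2\<close>, the lower bound for the derivative leaves
  \<open>sqrt (n * sin s) / 4\<close> in the denominator.\<close>

lemma node_endpoint_term:
  assumes n: "n \<ge> 1" and s: "0 < s" "s < pi"
    and root: "poly (legendre_poly n) (cos s) = 0"
    and \<mu>: "0 < \<mu>" "\<mu> / (3 * real n) \<le> sin s"
  shows "1 / (\<bar>poly (pderiv (legendre_poly n)) (cos s)\<bar> * (1 + cos s)) \<le> 8 / sqrt \<mu>"
proof -
  define D where "D = \<bar>poly (pderiv (legendre_poly n)) (cos s)\<bar>"
  have sin: "0 < sin s" using s by (rule sin_gt_zero)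
  have "(sin s)\<^sup>2 = (1 + cos s) * (1 - cos s)"
    by (simp add: sin_squared_eq power2_eq_square algebra_simps)
  also have "\<dots> \<le> (1 + cos s) * 2"
    using cos_ge_minus_one[of s] by (intro mult_left_mono) linarith+
  finally have c: "(sin s)\<^sup>2 / 2 \<le> 1 + cos s" by simp
  have "sqrt \<mu> / 8 \<le> sqrt (3 * real n * sin s) / 8"
    using \<mu> n by (simp add: divide_le_eq mult_ac)
  also have "\<dots> \<le> sqrt (4 * real n * sin s) / 8"
    using sin by (intro divide_right_mono real_sqrt_le_mono mult_right_mono) auto
  also have "\<dots> = (sqrt (real n) / 2) * (sqrt (sin s) / 2)"
    by (simp add: real_sqrt_mult)
  also have "\<dots> \<le> (sin s * sqrt (sin s) * D) * (sqrt (sin s) / 2)"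
    unfolding D_def using sin by (intro mult_right_mono legendre_deriv_at_zero_ge[OF n s root]) auto
  also have "\<dots> = D * (sin s * (sqrt (sin s) * sqrt (sin s)) / 2)" by (simp only: mult_ac times_divide_eq_left times_divide_eq_right)
  also have "\<dots> = D * ((sin s)\<^sup>2 / 2)"
    using sin by (simp add: power2_eq_square)
  also have "\<dots> \<le> D * (1 + cos s)" using c by (intro mult_left_mono) (auto simp: D_def)
  finally have "sqrt \<mu> / 8 \<le> D * (1 + cos s)" .
  moreover have "sqrt \<mu> / 8 > 0" using \<mu> by simp
  ultimately have "1 / (D * (1 + cos s)) \<le> 1 / (sqrt \<mu> / 8)"
    by (intro divide_left_mono mult_pos_pos[of "D * (1 + cos s)"]) linarith+
  then show ?thesis by (simp add: D_def)
qed

section \<open>Summation over all nodes\<close>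

theorem theorem4p1:
  shows "\<exists>C. \<forall>N::nat. N \<ge> 1 \<longrightarrow>
           lebesgue_constant (legendre_radau_nodes N) \<le> C * sqrt (real N)"
proof (intro exI[of _ 161] allI impI)
  fix n :: nat
  assume n: "n \<ge> 1"
  define p where "p = legendre_poly n"
  define L where "L = real n + 1 / 2"
  define Z where "Z = {x. poly p x = 0}"
  obtain \<theta> where lower: "\<And>k. k \<in> {1..n} \<Longrightarrow> (real k - 3 / 4) * pi / L < \<theta> k"
    and upper: "\<And>k. k \<in> {1..n} \<Longrightarrow> \<theta> k < (real k + 1 / 4) * pi / L"
    and inj: "inj_on (\<lambda>k. cos (\<theta> k)) {1..n}"
    and Z: "Z = (\<lambda>k. cos (\<theta> k)) ` {1..n}"
    unfolding L_def Z_def p_def using legendre_zeros[OF n] by metis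
  have L: "L > 0" "L \<le> 3 / 2 * real n" using n by (simp_all add: L_def)
  have fin: "finite Z" by (simp add: Z)
  have roots: "poly p x = 0 \<longleftrightarrow> x \<in> Z" for x by (simp add: Z_def)
  have deg: "degree p \<le> card Z"
    unfolding p_def Z card_image[OF inj] using degree_legendre_le[of n] by simp
  have p_end: "\<bar>poly p (-1)\<bar> = 1" by (simp add: p_def power_abs)
  then have end_not_root: "-1 \<notin> Z" by (auto simp: Z_def)
  have pi_upper: "(real k + 1 / 4) * pi / L = pi - (real n + 1 / 4 - real k) * pi / L" for k
    using L(1) by (simp add: field_simps) (simp add: L_def field_simps)
  \<comment> \<open>The minimum is the index distance \<open>\<mu>\<close> to the nearer end. Both
    \<open>\<theta> k\<close> and \<open>pi - \<theta> k\<close> are at least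
    \<open>\<mu> * pi / (4 * L)\<close>; Jordan's inequality and \<open>2 * L \<le> 3 * n\<close>
    finish.\<close>
  have in_pi: "0 < \<theta> k" "\<theta> k < pi" and sin_ge: "min (real k) (real n + 1 - real k) / (3 * real n) \<le> sin (\<theta> k)"
    if k: "k \<in> {1..n}" for k
  proof -
    define \<mu> where "\<mu> = min (real k) (real n + 1 - real k)"
    have \<mu>: "\<mu> \<ge> 1" "\<mu> \<le> real k" "\<mu> \<le> real n + 1 - real k" using k by (auto simp: \<mu>_def)
    have "\<mu> / 4 * pi / L \<le> (real k - 3 / 4) * pi / L" "\<mu> / 4 * pi / L \<le> (real n + 1 / 4 - real k) * pi / L"
      using L(1) \<mu> by (intro divide_right_mono mult_right_mono; simp)+
    then have *: "\<mu> / 4 * pi / L \<le> \<theta> k" "\<mu> / 4 * pi / L \<le> pi - \<theta> k"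
      using lower[OF k] upper[OF k] unfolding pi_upper by linarith+
    have pos: "0 < \<mu> / 4 * pi / L" using \<mu>(1) L(1) by simp
    show th: "0 < \<theta> k" "\<theta> k < pi" using * pos by linarith+
    define \<phi> where "\<phi> = min (\<theta> k) (pi - \<theta> k)"
    have "2 * \<phi> / pi \<le> sin \<phi>"
      using th by (intro jordan_sin_ge) (auto simp: \<phi>_def min_def)
    also have "sin \<phi> = sin (\<theta> k)" by (simp add: \<phi>_def min_def)
    finally have "2 * \<phi> / pi \<le> sin (\<theta> k)" .
    moreover have "2 * (\<mu> / 4 * pi / L) / pi \<le> 2 * \<phi> / pi"
      unfolding \<phi>_def by (intro divide_right_mono mult_left_mono min.boundedI *) auto
    moreover have "2 * (\<mu> / 4 * pi / L) / pi = \<mu> / (2 * L)" by simp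
    moreover have "\<mu> / (3 * real n) \<le> \<mu> / (2 * L)"
      using L \<mu>(1) by (intro divide_left_mono) auto
    ultimately show "min (real k) (real n + 1 - real k) / (3 * real n) \<le> sin (\<theta> k)"
      unfolding \<mu>_def by linarith
  qed
  have bound: "(\<Sum>ti\<in>insert (-1) Z. \<bar>lagrange_basis (insert (-1) Z) ti x\<bar>) \<le> 161 * sqrt (real n)"
    if x: "x \<in> {-1..1}" for x
  proof -
    define t where "t = arccos x"
    have t: "t \<in> {0..pi}" "x = cos t" using x by (auto simp: t_def arccos_lbound arccos_ubound)
    \<comment> \<open>Position of \<open>t\<close> on the index scale: the same map sends
      \<open>\<theta> k\<close> to within \<open>1 / 2\<close> of \<open>k\<close>. The nearest
      index \<open>m\<close> may be 0 or \<open>n + 1\<close>, to which no zero belongs.\<close>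
    define y where "y = t * L / pi + 1 / 4"
    define m where "m = nat (round y)"
    have "t * L / pi \<le> L"
      using t(1) L(1) mult_right_mono[of t pi L] by (simp add: pos_divide_le_eq mult.commute)
    moreover have "0 \<le> t * L / pi" using t(1) L(1) by simp
    ultimately have y: "1 / 4 \<le> y" "y \<le> real n + 3 / 4"
      by (simp_all add: y_def L_def)
    have round_y: "\<bar>of_int (round y) - y\<bar> \<le> 1 / 2" by (rule of_int_round_abs_le)
    have "round y \<ge> 0" using y(1) round_y by linarith
    then have m: "\<bar>real m - y\<bar> \<le> 1 / 2" using round_y by (simp add: m_def)
    have m_le: "m \<le> n + 1" using m y(2) by linarith
    define l where "l k = (\<Prod>s\<in>Z - {cos (\<theta> k)}. (x - s) / (cos (\<theta> k) - s))" for k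
    have l: "l k * (cos t - cos (\<theta> k)) * poly (pderiv (legendre_poly n)) (cos (\<theta> k))
        = poly (legendre_poly n) (cos t)" if "k \<in> {1..n}" for k
      using lagrange_prod_at_root[OF fin roots deg, of "cos (\<theta> k)" x] that
      by (auto simp: l_def Z t(2) p_def)
    have root: "poly (legendre_poly n) (cos (\<theta> k)) = 0" if "k \<in> {1..n}" for k
      using roots that unfolding Z p_def by auto
    have l1: "l k = 1" if "t = \<theta> k" for k
      unfolding l_def t(2) that by (rule prod.neutral) auto
    \<comment> \<open>One bound for near and far nodes lets the sum split without partitioning the
      indices; at \<open>k = m\<close> the last term is 0 by convention.\<close>
    have l_le: "\<bar>l k\<bar> \<le> (if \<bar>real k - real m\<bar> \<le> 1 then 16 * sqrt (real n) else 0)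
        + 20 * (1 / sqrt \<bar>real k - real m\<bar>)" if k: "k \<in> {1..n}" for k
    proof (cases "\<bar>real k - real m\<bar> \<le> 1")
      case True
      have "\<bar>l k\<bar> \<le> 16 * sqrt (real n)"
        using node_factor_near[OF n t(1) in_pi[OF k] root[OF k] l[OF k] l1] .
      moreover have "0 \<le> 20 * (1 / sqrt \<bar>real k - real m\<bar>)" by simp
      ultimately show ?thesis unfolding if_P[OF True] by linarith
    next
      case False
      define j where "j = \<bar>real k - real m\<bar>"
      \<comment> \<open>Integrality sharpens \<open>j > 1\<close> to
        \<open>j \<ge> 2\<close>.\<close>
      define i where "i = \<bar>int k - int m\<bar>"
      have ji: "j = of_int i" by (simp add: j_def i_def)
      have "2 \<le> i" using False unfolding j_def[symmetric] ji by simp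
      then have j: "2 \<le> j" unfolding ji by simp
      have "\<bar>\<theta> k * L / pi - (real k - 1 / 4)\<bar> \<le> 1 / 2"
        using lower[OF k] upper[OF k] L(1) by (auto simp: abs_le_iff field_simps)
      then have "j - 1 \<le> \<bar>t * L / pi - \<theta> k * L / pi\<bar>"
        using m unfolding j_def y_def by linarith
      also have "\<dots> = \<bar>t - \<theta> k\<bar> * L / pi"
        using L(1) by (simp add: abs_mult flip: diff_divide_distrib left_diff_distrib)
      finally have "(j - 1) * pi \<le> \<bar>t - \<theta> k\<bar> * L" by (simp add: le_divide_eq)
      \<comment> \<open>For \<open>j \<ge> 2\<close> one has \<open>j - 1 \<ge> j / 2\<close>; the
        factor 3 below \<open>pi\<close> then balances \<open>L \<le> 3 / 2 * n\<close>.\<close>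
      moreover have "j / 2 * 3 \<le> (j - 1) * pi" using j pi_gt3 by (intro mult_mono) auto
      moreover have "\<bar>t - \<theta> k\<bar> * L \<le> \<bar>t - \<theta> k\<bar> * (3 / 2 * real n)"
        using L(2) by (intro mult_left_mono) auto
      ultimately have "j \<le> \<bar>t - \<theta> k\<bar> * real n" by linarith
      then have "j / real n \<le> \<bar>t - \<theta> k\<bar>" using n by (simp add: divide_le_eq)
      then have "\<bar>l k\<bar> \<le> 20 / sqrt j"
        using j by (intro node_factor_far[OF n t(1) in_pi[OF k] root[OF k] l[OF k]]) auto
      then show ?thesis using False by (simp add: j_def)
    qed
    have basis_le: "\<bar>lagrange_basis (insert (-1) Z) (cos (\<theta> k)) x\<bar>
        \<le> \<bar>l k\<bar> + 8 * (1 / sqrt (real k)) + 8 * (1 / sqrt (real (n + 1 - k)))" if k: "k \<in> {1..n}" for k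
    proof -
      define \<tau> D where "\<tau> = cos (\<theta> k)" and "D = poly (pderiv (legendre_poly n)) \<tau>"
      define \<mu> where "\<mu> = min (real k) (real n + 1 - real k)"
      have \<mu>: "\<mu> \<ge> 1" using k by (auto simp: \<mu>_def)
      have \<tau>: "\<tau> \<in> Z" "1 + \<tau> > 0"
        using k cos_monotone_0_pi[OF _ in_pi(2)[OF k]] in_pi[OF k] by (auto simp: \<tau>_def Z)
      have D: "D \<noteq> 0"
        using legendre_deriv_at_zero_ge[OF n in_pi[OF k] root[OF k]] n by (auto simp: D_def \<tau>_def)
      have "insert (-1) Z - {\<tau>} = insert (-1) (Z - {\<tau>})" using \<tau>(2) by auto
      then have "lagrange_basis (insert (-1) Z) \<tau> x = (x + 1) / (\<tau> + 1) * l k"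
        using end_not_root fin by (simp add: lagrange_basis_def l_def \<tau>_def)
      \<comment> \<open>The factor contributed by the node -1 is
        \<open>1 + (x - \<tau>) / (1 + \<tau>)\<close>, and \<open>l k * (x - \<tau>)\<close> has
        the closed form \<open>P_n(x) / P_n'(\<tau>)\<close>.\<close>
      also have "\<dots> = l k + l k * (x - \<tau>) / (1 + \<tau>)"
        using \<tau>(2) by (simp add: field_simps)
      also have "l k * (x - \<tau>) = poly (legendre_poly n) x / D"
        using l[OF k] D by (simp add: t(2) D_def \<tau>_def nonzero_eq_divide_eq)
      finally have "\<bar>lagrange_basis (insert (-1) Z) \<tau> x\<bar>
          \<le> \<bar>l k\<bar> + \<bar>poly (legendre_poly n) x / D / (1 + \<tau>)\<bar>"
        by (metis abs_triangle_ineq)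
      also have "\<bar>poly (legendre_poly n) x / D / (1 + \<tau>)\<bar>
          = \<bar>poly (legendre_poly n) x\<bar> * (1 / (\<bar>D\<bar> * (1 + \<tau>)))"
        using \<tau>(2) by (simp add: abs_divide abs_mult)
      also have "\<dots> \<le> 1 * (1 / (\<bar>D\<bar> * (1 + \<tau>)))"
        using \<tau>(2) x by (intro mult_right_mono abs_legendre_le_1) auto
      also have "\<dots> \<le> 8 / sqrt \<mu>"
        using node_endpoint_term[OF n in_pi[OF k] root[OF k] _ sin_ge[OF k]] \<mu>
        unfolding D_def \<tau>_def \<mu>_def by simp
      \<comment> \<open>The term for the nearer end is bounded by the sum over both ends, which is
        easier to sum over \<open>k\<close>.\<close>
      also have "\<dots> \<le> 8 * (1 / sqrt (real k)) + 8 * (1 / sqrt (real (n + 1 - k)))"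
        using k by (auto simp: \<mu>_def min_def of_nat_diff add.commute)
      finally show ?thesis by (simp add: \<tau>_def add.assoc)
    qed
    have basis_end: "\<bar>lagrange_basis (insert (-1) Z) (-1) x\<bar> \<le> 1"
    proof -
      have "insert (-1) Z - {-1} = Z" using end_not_root by auto
      then have "lagrange_basis (insert (-1) Z) (-1) x = poly p x / poly p (-1)"
        unfolding lagrange_basis_def
        using lagrange_prod_off_roots[OF fin roots deg end_not_root, of x] by simp
      then show ?thesis
        using p_end abs_legendre_le_1[of x n] x by (simp add: abs_divide p_def abs_le_iff)
    qed
    have near: "(\<Sum>k = 1..n. if \<bar>real k - real m\<bar> \<le> 1 then 16 * sqrt (real n) else 0) \<le> 48 * sqrt (real n)"
    proof -
      \<comment> \<open>For \<open>m = 0\<close> the truncated \<open>m - 1\<close> is 0 and merely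
        repeats \<open>m\<close>.\<close>
      have "{1..n} \<inter> {k. \<bar>real k - real m\<bar> \<le> 1} \<subseteq> {m - 1, m, m + 1}" by auto
      then have "card ({1..n} \<inter> {k. \<bar>real k - real m\<bar> \<le> 1}) \<le> card {m - 1, m, m + 1}"
        by (intro card_mono) auto
      also have "\<dots> \<le> 3" by (simp add: card_insert_if)
      finally have "real (card ({1..n} \<inter> {k. \<bar>real k - real m\<bar> \<le> 1})) * (16 * sqrt (real n))
          \<le> 3 * (16 * sqrt (real n))"
        by (intro mult_right_mono) auto
      then show ?thesis by (simp add: sum.If_cases)
    qed
    have rev: "(\<Sum>k = 1..n. 1 / sqrt (real (n + 1 - k))) \<le> 2 * sqrt (real n)"
      by (rule sum_inverse_sqrt_reindex_le) (auto intro!: inj_onI)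
    have "(\<Sum>ti\<in>insert (-1) Z. \<bar>lagrange_basis (insert (-1) Z) ti x\<bar>)
        = \<bar>lagrange_basis (insert (-1) Z) (-1) x\<bar>
          + (\<Sum>k = 1..n. \<bar>lagrange_basis (insert (-1) Z) (cos (\<theta> k)) x\<bar>)"
      using end_not_root fin inj by (simp add: Z sum.reindex)
    also have "\<dots> \<le> 1 + (\<Sum>k = 1..n. ((if \<bar>real k - real m\<bar> \<le> 1 then 16 * sqrt (real n) else 0)
          + 20 * (1 / sqrt \<bar>real k - real m\<bar>))
        + 8 * (1 / sqrt (real k)) + 8 * (1 / sqrt (real (n + 1 - k))))"
      by (intro add_mono basis_end sum_mono order_trans[OF basis_le] l_le order_refl)
    also have "\<dots> = 1 + ((\<Sum>k = 1..n. if \<bar>real k - real m\<bar> \<le> 1 then 16 * sqrt (real n) else 0)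
          + 20 * (\<Sum>k = 1..n. 1 / sqrt \<bar>real k - real m\<bar>)
        + 8 * (\<Sum>k = 1..n. 1 / sqrt (real k)) + 8 * (\<Sum>k = 1..n. 1 / sqrt (real (n + 1 - k))))"
      by (simp only: sum.distrib sum_distrib_left)
    \<comment> \<open>The constant is \<open>1 + 48 + 20 * 4 + 8 * 2 + 8 * 2\<close>.\<close>
    also have "\<dots> \<le> 161 * sqrt (real n)"
    proof -
      have "1 \<le> sqrt (real n)" using n by simp
      with near rev sum_inverse_sqrt_dist_le[OF m_le] sum_inverse_sqrt_le[of n]
      show ?thesis by linarith
    qed
    finally show ?thesis .
  qed
  have "legendre_radau_nodes n = insert (-1) Z"
    by (simp add: legendre_radau_nodes_def Z_def p_def)
  then show "lebesgue_constant (legendre_radau_nodes n) \<le> 161 * sqrt (real n)"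
    unfolding lebesgue_constant_def using bound by (intro cSUP_least) auto
qed

end
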